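(* Let $N\in\mathbb{N}$, $a\ge0$, $b>0$, and put $\alpha:=a+b-1$, $\beta:=b-1$. For $\kappa>0$ let $\tilde X_\kappa$ be a random variable with values in the trigonometric alcove $\tilde A:=\{t\in\mathbb{R}^N:\ \frac{\pi}{2}\ge t_1\ge\dots\ge t_N\ge 0\}$ whose distribution $\tilde\mu_\kappa$ has Lebesgue density $$\tilde c_\kappa\prod_{1\le i<j\le N}\bigl(\cos(2t_j)-\cos(2t_i)\bigr)^{\kappa}\prod_{i=1}^N\sin(t_i)^{\kappa a}\sin(2t_i)^{\kappa b}$$ on $\tilde A$, with normalizing constant $\tilde c_\kappa>0$. Let $z_1\le\dots\le z_N$ be the ordered zeros of the Jacobi polynomial $P_N^{(\alpha,\beta)}$. Then, as $\kappa\to\infty$, $\tilde X_\kappa$ converges in probability to $\bigl(\tfrac12\arccos z_1,\dots,\tfrac12\arccos z_N\bigr)$.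
   Context: For $\alpha,\beta>-1$, $P_N^{(\alpha,\beta)}$ denotes the classical Jacobi polynomial of degree $N$, orthogonal on $]-1,1[$ with respect to the weight $(1-x)^\alpha(1+x)^\beta$; its $N$ zeros are simple and lie in $]-1,1[$. *)

theory Defs
  imports "HOL-Probability.Probability"
begin

definition jacobiP :: "nat \<Rightarrow> real \<Rightarrow> real \<Rightarrow> real \<Rightarrow> real" where
  "jacobiP N al be x =
     (\<Sum>s\<le>N. ((real N + al) gchoose (N - s)) * ((real N + be) gchoose s)
              * ((x - 1) / 2) ^ s * ((x + 1) / 2) ^ (N - s))"

text \<open>Lebesgue measure on R^N, points represented as functions on indices {..<N}
  (index i corresponds to coordinate t_(i+1)).\<close>
abbreviation lebN :: "nat \<Rightarrow> (nat \<Rightarrow> real) measure" where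
  "lebN N \<equiv> PiM {..<N} (\<lambda>_. lborel)"

definition trig_alcove :: "nat \<Rightarrow> (nat \<Rightarrow> real) set" where
  "trig_alcove N = {t \<in> space (lebN N).
      (\<forall>i<N. 0 \<le> t i \<and> t i \<le> pi / 2) \<and> (\<forall>i j. i < j \<and> j < N \<longrightarrow> t j \<le> t i)}"

definition trig_density :: "nat \<Rightarrow> real \<Rightarrow> real \<Rightarrow> real \<Rightarrow> (nat \<Rightarrow> real) \<Rightarrow> real" where
  "trig_density N a b \<kappa> t =
     (\<Prod>j<N. \<Prod>i<j. (cos (2 * t j) - cos (2 * t i)) powr \<kappa>)
     * (\<Prod>i<N. sin (t i) powr (\<kappa> * a) * sin (2 * t i) powr (\<kappa> * b))"

end

theory Submission
  imports Defs "HOL-Computational_Algebra.Polynomial"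
begin

text \<open>The density is the \<open>\<kappa>\<close>-th power of one continuous weight on a compact alcove, so by Laplace's
  method the mass concentrates at the maximizer of that weight, provided it is unique. A maximizer
  \<open>t\<close> is interior, and with \<open>w\<^sub>i = sin\<^sup>2 t\<^sub>i\<close> its critical point equations are Stieltjes'
  electrostatic equilibrium conditions: they say that the polynomial with roots \<open>w\<^sub>i\<close> solves the
  hypergeometric differential equation. The resulting two-term recurrence determines its
  coefficients up to a factor, and the Jacobi polynomial at \<open>1 - 2w\<close> satisfies the same recurrence.
  Hence the \<open>cos (2 t\<^sub>i) = 1 - 2 w\<^sub>i\<close> are exactly the Jacobi zeros, which identifies every maximizer
  at once.\<close>

subsection \<open>Jacobi polynomials and the equilibrium equations\<close>

text \<open>Expanding \<open>(1 - w) ^ (N - s)\<close> and collecting powers of \<open>w\<close>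
  leaves a Vandermonde convolution over \<open>s\<close> at each power. The coefficients thus become
  single products, so consecutive ones have a simple ratio.\<close>

lemma jacobiP_expand_at_1:
  fixes al be w :: real
  shows "jacobiP N al be (1 - 2 * w) =
    (\<Sum>m\<le>N. ((real N + al) gchoose (N - m)) * ((real N + real m + al + be) gchoose m) * (- w) ^ m)"
proof -
  let ?A = "real N + al" and ?B = "real N + be"
  define g where "g s r = (?A gchoose (N - s)) * (?B gchoose s) * of_nat ((N - s) choose r) * (- w) ^ (s + r)" for s r
  have "jacobiP N al be (1 - 2 * w) = (\<Sum>s\<le>N. (?A gchoose (N - s)) * (?B gchoose s) * (- w) ^ s * (- w + 1) ^ (N - s))"
    unfolding jacobiP_def by (intro sum.cong refl arg_cong2[where f="(*)"] arg_cong2[where f="(^)"]) (auto simp: field_simps)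
  also have "\<dots> = (\<Sum>s\<le>N. \<Sum>r\<le>N - s. g s r)"
    by (rule sum.cong[OF refl], subst binomial_ring)
      (simp add: g_def sum_distrib_left power_add mult_ac)
  also have "\<dots> = (\<Sum>(s, r)\<in>{(s, r). s + r \<le> N}. g s r)"
    by (subst sum.Sigma) (auto intro!: sum.cong)
  also have "\<dots> = (\<Sum>m\<le>N. \<Sum>s\<le>m. g s (m - s))"
    by (rule sum.triangle_reindex_eq)
  also have "\<dots> = (\<Sum>m\<le>N. (?A gchoose (N - m)) * ((real N + real m + al + be) gchoose m) * (- w) ^ m)"
  proof (rule sum.cong[OF refl])
    fix m assume "m \<in> {..N}"
    then have m: "m \<le> N" by simp
    have "g s (m - s) = (?A gchoose (N - m)) * (- w) ^ m * ((?B gchoose s) * ((real m + al) gchoose (m - s)))"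
      if "s \<le> m" for s
    proof -
      \<comment> \<open>Trinomial revision splits off a factor free of \<open>s\<close>; what
        remains is the summand of Vandermonde's identity.\<close>
      have "(?A gchoose (N - s)) * (of_nat (N - s) gchoose (N - m)) = (?A gchoose (N - m)) * (?A - of_nat (N - m) gchoose (N - s - (N - m)))"
        by (rule gbinomial_trinomial_revision) (use that in auto)
      moreover have "(N - s) choose (m - s) = (N - s) choose (N - m)"
        by (subst binomial_symmetric) (use that m in auto)
      moreover have "?A - of_nat (N - m) = real m + al" "N - s - (N - m) = m - s" 
        using that m by (auto simp: of_nat_diff)
      ultimately have *: "(?A gchoose (N - s)) * real ((N - s) choose (m - s)) = (?A gchoose (N - m)) * ((real m + al) gchoose (m - s))"
        by (simp add: binomial_gbinomial add_ac)
      have "g s (m - s) = ((?A gchoose (N - s)) * real ((N - s) choose (m - s))) * (?B gchoose s) * (- w) ^ m"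
        using that by (simp add: g_def)
      then show ?thesis unfolding * by simp
    qed
    then have "(\<Sum>s\<le>m. g s (m - s)) = (?A gchoose (N - m)) * (- w) ^ m * (\<Sum>s\<le>m. (?B gchoose s) * ((real m + al) gchoose (m - s)))"
      by (simp add: sum_distrib_left)
    also have "(\<Sum>s\<le>m. (?B gchoose s) * ((real m + al) gchoose (m - s))) = (?B + (real m + al)) gchoose m"
      unfolding atMost_atLeast0 by (rule gbinomial_Vandermonde)
    finally show "(\<Sum>s\<le>m. g s (m - s)) = (?A gchoose (N - m)) * ((real N + real m + al + be) gchoose m) * (- w) ^ m"
      by (simp add: algebra_simps)
  qed
  finally show ?thesis .
qed

text \<open>Each generalized binomial is shifted by an absorption identity: one lowers
  \<open>N - m\<close>, the other raises \<open>m\<close> together with the upper index.\<close>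

lemma jacobi_coeff_recurrence:
  fixes al be :: real
  assumes "m < N"
  defines "J \<equiv> \<lambda>m. ((real N + al) gchoose (N - m)) * ((real N + real m + al + be) gchoose m) * (-1) ^ m"
  shows "real (m + 1) * (real m + al + 1) * J (Suc m) =
    - (real N - real m) * (real N + real m + al + be + 1) * J m"
proof -
  obtain k where N: "N = Suc (m + k)" using assms(1) less_imp_Suc_add by blast
  let ?A = "real N + al" and ?S = "real N + real m + al + be"
  have "real (Suc k) * (?A gchoose Suc k) = (?A - real k) * (?A gchoose k)"
    by (metis gbinomial_absorb_comp gbinomial_absorption)
  then have 1: "(real N - real m) * (?A gchoose (N - m)) = (real m + al + 1) * (?A gchoose (N - Suc m))"
    by (simp add: N algebra_simps)
  have 2: "real (m + 1) * ((?S + 1) gchoose Suc m) = (?S + 1) * (?S gchoose m)"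
    using gbinomial_absorption'[of "Suc m" "?S + 1"] by (simp del: of_nat_Suc)
  have "real (m + 1) * (real m + al + 1) * J (Suc m) =
     - ((real m + al + 1) * (?A gchoose (N - Suc m))) * (real (m + 1) * ((?S + 1) gchoose Suc m)) * (-1) ^ m"
    by (simp add: J_def algebra_simps)
  also have "\<dots> = - (real N - real m) * (?S + 1) * J m"
    unfolding 1[symmetric] 2 by (simp add: J_def algebra_simps)
  finally show ?thesis .
qed

section \<open>Derivatives of a product of linear factors\<close>

lemma poly_pderiv_prod_linear:
  fixes w :: "'a \<Rightarrow> 'b::field"
  assumes "finite I" and "\<And>j. j \<in> I \<Longrightarrow> x \<noteq> w j"
  shows "poly (pderiv (\<Prod>j\<in>I. [:- w j, 1:])) x = poly (\<Prod>j\<in>I. [:- w j, 1:]) x * (\<Sum>j\<in>I. 1 / (x - w j))"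
  using assms
proof (induction I rule: finite_induct)
  case (insert i I)
  let ?r = "\<Prod>j\<in>I. [:- w j, 1:]"
  have "pderiv ([:- w i, 1:] * ?r) = [:- w i, 1:] * pderiv ?r + ?r"
    by (subst pderiv_mult) (simp add: pderiv_pCons)
  moreover have "x \<noteq> w i" using insert.prems by simp
  ultimately show ?case
    using insert by (simp del: mult_pCons_left add: distrib_left)
qed simp

text \<open>Writing \<open>q\<close> as (x - w k) times \<open>r\<close> gives q' = r and q'' = 2 r'
  at \<open>w k\<close>, and r' / r is a sum of reciprocals. This turns the sums in the equilibrium
  conditions into derivatives of \<open>q\<close>.\<close>

lemma pderiv_prod_linear_at_root:
  fixes w :: "'a \<Rightarrow> 'b::field" and q :: "'b poly"
  assumes "finite I" "k \<in> I" "inj_on w I"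
  defines "q \<equiv> \<Prod>j\<in>I. [:- w j, 1:]"
  shows "poly (pderiv (pderiv q)) (w k) = 2 * poly (pderiv q) (w k) * (\<Sum>j\<in>I - {k}. 1 / (w k - w j))"
proof -
  define r where "r = (\<Prod>j\<in>I - {k}. [:- w j, 1:])"
  have q: "q = [:- w k, 1:] * r"
    unfolding q_def r_def using assms by (subst prod.remove[of _ k]) auto
  have "poly (pderiv r) (w k) = poly r (w k) * (\<Sum>j\<in>I - {k}. 1 / (w k - w j))"
    unfolding r_def using assms by (intro poly_pderiv_prod_linear) (auto dest: inj_onD)
  moreover have q': "pderiv q = [:- w k, 1:] * pderiv r + r"
    unfolding q by (subst pderiv_mult) (simp add: pderiv_pCons)
  moreover have "pderiv (pderiv q) = [:- w k, 1:] * pderiv (pderiv r) + 2 * pderiv r"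
    unfolding q' pderiv_add by (subst pderiv_mult) (simp add: pderiv_pCons)
  ultimately show ?thesis by simp
qed

lemma degree_prod_linear:
  fixes w :: "'a \<Rightarrow> 'b::field"
  assumes "finite I"
  shows "degree (\<Prod>j\<in>I. [:- w j, 1:]) = card I"
  by (subst degree_prod_eq_sum_degree) (use assms in auto)

text \<open>The Jacobi zeros need not be known beforehand: equilibrium forces the polynomial with
  roots \<open>w k\<close> to be a multiple of the Jacobi polynomial, so all real zeros of the
  latter are found at once.\<close>

lemma jacobi_zeros_of_stationary:
  fixes w :: "nat \<Rightarrow> real" and al be :: real
  assumes al: "al > -1" and inj: "inj_on w {..<N}"
    and pos: "\<And>k. k < N \<Longrightarrow> 0 < w k" and less1: "\<And>k. k < N \<Longrightarrow> w k < 1"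
    and stat: "\<And>k. k < N \<Longrightarrow>
      (\<Sum>j\<in>{..<N} - {k}. 1 / (w k - w j)) + (al + 1) / (2 * w k) - (be + 1) / (2 * (1 - w k)) = 0"
  shows "{x. jacobiP N al be x = 0} = (\<lambda>k. 1 - 2 * w k) ` {..<N}"
proof -
  define q where "q = (\<Prod>j<N. [:- w j, 1:])"
  \<comment> \<open>\<open>D\<close> is the hypergeometric operator y (1 - y) q'' + (al + 1 - (al +
    be + 2) y) q' + L q. The eigenvalue \<open>L\<close> is chosen so that the coefficient of degree
    \<open>N\<close> cancels.\<close>
  define L where "L = real N * (real N + al + be + 1)"
  define D where "D = [:0, 1, -1:] * pderiv (pderiv q) + [:al + 1, - (al + be + 2):] * pderiv q + smult L q"
  have degq: "degree q = N" unfolding q_def by (simp add: degree_prod_linear)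
  have coeffD: "coeff D s = (real s + 1) * (real s + al + 1) * coeff q (Suc s)
      + (L - real s * (real s + al + be + 1)) * coeff q s" for s
  proof -
    consider "s = 0" | "s = 1" | r where "s = Suc (Suc r)" by (metis One_nat_def not0_implies_Suc)
    then show ?thesis
      by cases (auto simp: D_def coeff_pderiv algebra_simps)
  qed
  have Dk: "poly D (w k) = 0" if k: "k < N" for k
  proof -
    let ?S = "\<Sum>j\<in>{..<N} - {k}. 1 / (w k - w j)" and ?q' = "poly (pderiv q) (w k)"
    have "poly (pderiv (pderiv q)) (w k) = 2 * ?q' * ?S"
      unfolding q_def using k inj by (intro pderiv_prod_linear_at_root) auto
    moreover have "poly q (w k) = 0" unfolding q_def using k by (auto simp: poly_prod)
    \<comment> \<open>The term with \<open>q\<close> vanishes at its root, and the bracket is 2 w (1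
      - w) times the left side of \<open>stat\<close>, with w = \<open>w k\<close>.\<close>
    ultimately have "poly D (w k) = ?q' * (2 * w k * (1 - w k) * ?S + (al + 1) * (1 - w k) - (be + 1) * w k)"
      by (simp add: D_def algebra_simps)
    moreover have "?S = (be + 1) / (2 * (1 - w k)) - (al + 1) / (2 * w k)" using stat[OF k] by linarith
    moreover have "2 * w k * (1 - w k) * ((be + 1) / (2 * (1 - w k)) - (al + 1) / (2 * w k)) = (be + 1) * w k - (al + 1) * (1 - w k)"
      using pos[OF k] less1[OF k] by (simp add: field_simps)
    ultimately show ?thesis by (simp only:) simp
  qed
  \<comment> \<open>By the choice of \<open>L\<close>, a nonzero \<open>D\<close> would have degree
    below \<open>N\<close>, yet it has the \<open>N\<close> distinct roots
    \<open>w k\<close>.\<close>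
  have "D = 0"
  proof (rule ccontr)
    assume "D \<noteq> 0"
    have z: "coeff D s = 0" if "s \<ge> N" for s
    proof (cases "s = N")
      case True
      then show ?thesis unfolding coeffD by (simp add: coeff_eq_0 degq L_def)
    next
      case False
      then show ?thesis unfolding coeffD using that by (simp add: coeff_eq_0 degq)
    qed
    then have "degree D < N" using \<open>D \<noteq> 0\<close> by (meson leading_coeff_0_iff not_le)
    moreover have "card (w ` {..<N}) \<le> card {x. poly D x = 0}"
      using Dk \<open>D \<noteq> 0\<close> by (intro card_mono poly_roots_finite) auto
    moreover have "card {x. poly D x = 0} \<le> degree D" 
      using \<open>D \<noteq> 0\<close> by (rule card_poly_roots_bound)
    ultimately show False using inj by (simp add: card_image)
  qed
  define J where "J = (\<lambda>m. ((real N + al) gchoose (N - m)) * ((real N + real m + al + be) gchoose m) * (-1) ^ m)"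
  \<comment> \<open>Both coefficient sequences obey the same two-term recurrence, and
    \<open>al > -1\<close> makes its leading factor nonzero. The cross-multiplied form avoids
    division by the initial values.\<close>
  have proportional: "J 0 * coeff q m = coeff q 0 * J m" if "m \<le> N" for m
    using that
  proof (induction m)
    case (Suc m)
    let ?c = "(real m + 1) * (real m + al + 1)" and ?e = "- (real N - real m) * (real N + real m + al + be + 1)"
    have "?c * J (Suc m) = ?e * J m"
      using jacobi_coeff_recurrence[of m N al be] Suc.prems by (simp add: J_def add_ac)
    moreover have "?c * coeff q (Suc m) = ?e * coeff q m"
      using coeffD[of m] \<open>D = 0\<close> by (simp add: L_def algebra_simps)
    moreover have "?c \<noteq> 0" using al by simp
    moreover have "J 0 * coeff q m = coeff q 0 * J m" using Suc by simp
    ultimately have "?c * (J 0 * coeff q (Suc m)) = ?c * (coeff q 0 * J (Suc m))"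
      by (metis mult.left_commute)
    with \<open>?c \<noteq> 0\<close> show ?case by simp
  qed simp
  have eq: "J 0 * poly q y = coeff q 0 * jacobiP N al be (1 - 2 * y)" for y
  proof -
    have "J 0 * poly q y = (\<Sum>m\<le>N. J 0 * coeff q m * y ^ m)"
      by (simp add: poly_altdef degq sum_distrib_left mult_ac)
    also have "\<dots> = (\<Sum>m\<le>N. coeff q 0 * (J m * y ^ m))"
      using proportional by (intro sum.cong) auto
    also have "\<dots> = coeff q 0 * jacobiP N al be (1 - 2 * y)"
      unfolding jacobiP_expand_at_1 J_def power_minus[of y] by (simp add: sum_distrib_left mult_ac)
    finally show ?thesis .
  qed
  \<comment> \<open>Both proportionality factors are nonzero: up to a factorial \<open>J 0\<close>
    is the product of al + 1, ..., al + N, and up to sign \<open>coeff q 0\<close> is the product of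
    the positive \<open>w k\<close>.\<close>
  have "J 0 \<noteq> 0"
  proof -
    have "(real N + al) gchoose N \<noteq> 0"
      unfolding gbinomial_prod_rev using al by auto
    then show ?thesis by (simp add: J_def)
  qed
  moreover have "coeff q 0 \<noteq> 0"
    using pos by (force simp: q_def poly_0_coeff_0[symmetric] poly_prod)
  ultimately have zero_iff: "jacobiP N al be (1 - 2 * y) = 0 \<longleftrightarrow> poly q y = 0" for y
    using eq[of y] by (metis mult_eq_0_iff)
  have "jacobiP N al be x = 0 \<longleftrightarrow> (\<exists>k<N. x = 1 - 2 * w k)" for x
    using zero_iff[of "(1 - x) / 2"] by (auto simp: q_def poly_prod field_simps)
  then show ?thesis by auto
qed

subsection \<open>The weight on the alcove\<close>

text \<open>Since \<open>sin (2 t) = 2 sin t cos t\<close>, the two sine powers combine to the exponent \<open>a + b > 0\<close>. This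
  keeps the weight continuous at the walls even for \<open>a = 0\<close>, where \<open>sin t powr a\<close> jumps because
  \<open>0 powr 0 = 0\<close>.\<close>

definition alcove_weight :: "nat \<Rightarrow> real \<Rightarrow> real \<Rightarrow> (nat \<Rightarrow> real) \<Rightarrow> real" where
  "alcove_weight N a b t = (\<Prod>j<N. \<Prod>i<j. cos (2 * t j) - cos (2 * t i))
     * (\<Prod>i<N. sin (t i) powr (a + b) * (2 * cos (t i)) powr b)"

text \<open>Coordinates from \<open>N\<close> on are left free, unlike in
  \<open>trig_alcove\<close>, so that the set is open in the product topology on
  \<open>nat \<Rightarrow> real\<close>.\<close>

definition open_alcove :: "nat \<Rightarrow> (nat \<Rightarrow> real) set" where
  "open_alcove N = {t. (\<forall>i<N. 0 < t i \<and> t i < pi / 2) \<and> (\<forall>i j. i < j \<and> j < N \<longrightarrow> t j < t i)}"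

lemma trig_density_eq: "trig_density N a b \<kappa> t = alcove_weight N a b t powr \<kappa>"
proof -
  have "sin x powr (\<kappa> * a) * sin (2 * x) powr (\<kappa> * b) = (sin x powr (a + b) * (2 * cos x) powr b) powr \<kappa>" for x :: real
    unfolding sin_double by (simp add: powr_mult powr_powr powr_add algebra_simps)
  then show ?thesis
    by (simp add: trig_density_def alcove_weight_def powr_mult prod_powr_distrib)
qed

lemma trig_alcove_eq: "trig_alcove N = {t \<in> PiE {..<N} (\<lambda>_. {0..pi / 2}). \<forall>j<N. \<forall>i<j. t j \<le> t i}"
  unfolding trig_alcove_def by (auto simp: space_PiM PiE_iff)

lemma trig_alcove_cos_double_le: "cos (2 * t i) \<le> cos (2 * t j)" if "t \<in> trig_alcove N" "i < j" "j < N"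
proof (rule cos_monotone_0_pi_le)
  have "0 \<le> t j" "t j \<le> t i" "t i \<le> pi / 2"
    using that by (auto simp: trig_alcove_def)
  then show "0 \<le> 2 * t j" "2 * t j \<le> 2 * t i" "2 * t i \<le> pi"
    by auto
qed

lemma open_alcove_cos_double_less:
  assumes "t \<in> open_alcove N" "i < j" "j < N"
  shows "cos (2 * t i) < cos (2 * t j)"
proof (rule cos_monotone_0_pi)
  have "0 < t j" "t j < t i" "t i < pi / 2"
    using assms by (auto simp: open_alcove_def)
  then show "0 \<le> 2 * t j" "2 * t j < 2 * t i" "2 * t i \<le> pi"
    by auto
qed

lemma open_alcove_sin_cos_pos:
  assumes "t \<in> open_alcove N" "i < N"
  shows "0 < sin (t i)" and "0 < cos (t i)"
  using assms by (auto simp: open_alcove_def intro!: sin_gt_zero2 cos_gt_zero)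

lemma alcove_weight_nonneg:
  assumes "t \<in> trig_alcove N" shows "alcove_weight N a b t \<ge> 0"
  unfolding alcove_weight_def
  using trig_alcove_cos_double_le[OF assms] by (intro mult_nonneg_nonneg prod_nonneg ballI) auto

lemma alcove_weight_pos:
  assumes "t \<in> open_alcove N" shows "alcove_weight N a b t > 0"
proof -
  have "(\<Prod>j<N. \<Prod>i<j. cos (2 * t j) - cos (2 * t i)) > 0"
    using open_alcove_cos_double_less[OF assms] by (intro prod_pos) auto
  moreover have "(\<Prod>i<N. sin (t i) powr (a + b) * (2 * cos (t i)) powr b) > 0"
    using open_alcove_sin_cos_pos[OF assms] by (intro prod_pos) force
  ultimately show ?thesis
    unfolding alcove_weight_def by simp
qed

text \<open>On every wall some factor vanishes: equal coordinates kill a cosine difference, the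
  endpoints 0 and pi / 2 kill a sine or a cosine power.\<close>

lemma open_alcoveI:
  assumes t: "t \<in> trig_alcove N" and nz: "alcove_weight N a b t \<noteq> 0"
  shows "t \<in> open_alcove N"
proof -
  have nz1: "cos (2 * t j) \<noteq> cos (2 * t i)" if "i < j" "j < N" for i j
    using nz that by (auto simp: alcove_weight_def)
  have nz2: "sin (t i) \<noteq> 0" "cos (t i) \<noteq> 0" if "i < N" for i
    using nz that by (auto simp: alcove_weight_def)
  have "t i \<noteq> 0" "t i \<noteq> pi / 2" if "i < N" for i
    using nz2[OF that] by (metis sin_zero, metis cos_pi_half)
  moreover have "t j \<noteq> t i" if "i < j" "j < N" for i j
    using nz1[OF that] by auto
  ultimately show ?thesis
    using t by (force simp: trig_alcove_def open_alcove_def less_le)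
qed

section \<open>Topology of the alcove and continuity of the weight\<close>

lemma open_open_alcove: "open (open_alcove N)"
proof -
  have "open_alcove N = (\<Inter>i\<in>{..<N}. {t. 0 < t i} \<inter> {t. t i < pi / 2}) \<inter> (\<Inter>j\<in>{..<N}. \<Inter>i\<in>{..<j}. {t. t j < t i})"
    by (auto simp: open_alcove_def)
  also have "open \<dots>"
    by (intro open_Int open_INT ballI open_Collect_less continuous_intros) auto
  finally show ?thesis .
qed

lemma open_alcove_subset: "t \<in> open_alcove N \<Longrightarrow> t \<in> extensional {..<N} \<Longrightarrow> t \<in> trig_alcove N"
  by (auto simp: open_alcove_def trig_alcove_def space_PiM PiE_iff less_imp_le)

text \<open>An extensional product is a full product with the compact factor
  \<open>{undefined}\<close> outside \<open>I\<close>, so Tychonoff's theorem applies.\<close>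

lemma compact_PiE:
  fixes S :: "'a \<Rightarrow> 'b::topological_space set"
  assumes "\<And>i. i \<in> I \<Longrightarrow> compact (S i)"
  shows "compact (PiE I S)"
proof -
  define T where "T i = (if i \<in> I then S i else {undefined})" for i
  have "PiE I S = PiE UNIV T"
    by (auto simp: PiE_iff T_def extensional_def split: if_splits)
  moreover have "compactin (product_topology (\<lambda>_. euclidean) UNIV) (PiE UNIV T)"
    unfolding compactin_PiE using assms by (auto simp: T_def)
  ultimately show ?thesis
    by (simp add: euclidean_product_topology)
qed

lemma compact_trig_alcove: "compact (trig_alcove N)"
proof -
  have "trig_alcove N = PiE {..<N} (\<lambda>_. {0..pi / 2}) \<inter> (\<Inter>j\<in>{..<N}. \<Inter>i\<in>{..<j}. {t. t j \<le> t i})"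
    unfolding trig_alcove_eq by auto
  also have "compact \<dots>"
    by (intro compact_Int_closed compact_PiE closed_INT ballI closed_Collect_le continuous_intros) auto
  finally show ?thesis .
qed

text \<open>The domain omits ordering and extensionality so as to contain both the compact alcove,
  where the maximum is attained, and the open one, where preimages of open sets are open. Positive
  exponents keep \<open>powr\<close> continuous at base 0.\<close>

lemma continuous_on_alcove_weight:
  assumes "a + b > 0" "b > 0"
  shows "continuous_on {t. \<forall>i<N. 0 \<le> t i \<and> t i \<le> pi / 2} (alcove_weight N a b)"
proof -
  let ?S = "{t :: nat \<Rightarrow> real. \<forall>i<N. 0 \<le> t i \<and> t i \<le> pi / 2}"
  have coord: "continuous_on ?S (\<lambda>t. t i)" for i
    by (rule continuous_on_subset[OF continuous_on_product_coordinates]) simp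
  have "continuous_on ?S (\<lambda>t. sin (t i) powr (a + b))" if "i < N" for i
    using assms that
    by (intro continuous_on_powr' continuous_on_sin coord continuous_on_const) (auto intro!: sin_ge_zero)
  moreover have "continuous_on ?S (\<lambda>t. (2 * cos (t i)) powr b)" if "i < N" for i
    using assms that
    by (intro continuous_on_powr' continuous_on_mult continuous_on_cos coord continuous_on_const) (auto intro!: cos_ge_zero)
  moreover have "continuous_on ?S (\<lambda>t. cos (2 * t j) - cos (2 * t i))" for i j
    by (intro continuous_on_diff continuous_on_cos continuous_on_mult coord continuous_on_const)
  ultimately show ?thesis
    unfolding alcove_weight_def by (intro continuous_on_mult continuous_on_prod) auto
qed

text \<open>Openness refers to all of \<open>nat \<Rightarrow> real\<close>, the measure to
  extensional functions. A basic open box around \<open>t\<close>, cut down to the first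
  \<open>N\<close> coordinates, bridges the two: its points agree with \<open>t\<close> at all other
  indices.\<close>

lemma positive_measure_box:
  fixes U :: "(nat \<Rightarrow> real) set"
  assumes U: "open U" "t \<in> U" and t: "t \<in> extensional {..<N}"
  obtains B where "B \<in> sets (lebN N)" "emeasure (lebN N) B > 0" "B \<subseteq> U"
proof -
  have "openin (product_topology (\<lambda>_. euclidean) UNIV) U"
    using U(1) by (simp add: euclidean_product_topology)
  from product_topology_open_contains_basis[OF this U(2)]
  obtain V where V: "t \<in> (\<Pi>\<^sub>E i\<in>UNIV. V i)" "\<And>i. open (V i)" "(\<Pi>\<^sub>E i\<in>UNIV. V i) \<subseteq> U"
    by auto
  interpret product_sigma_finite "\<lambda>_::nat. lborel :: real measure" ..
  have m: "V i \<in> sets lborel" for i using V(2) by auto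
  have "emeasure (lebN N) (\<Pi>\<^sub>E i\<in>{..<N}. V i) = (\<Prod>i<N. emeasure lborel (V i))"
    using m by (intro emeasure_PiM) auto
  moreover have "emeasure lborel (V i) > 0" for i
  proof -
    obtain e where e: "e > 0" "ball (t i) e \<subseteq> V i"
      using V(1,2) open_contains_ball by (metis PiE_mem UNIV_I)
    then have "emeasure lborel {t i - e <..< t i + e} \<le> emeasure lborel (V i)"
      using m by (intro emeasure_mono) (auto simp: ball_eq_greaterThanLessThan)
    moreover have "emeasure lborel {t i - e <..< t i + e} > 0" using e by simp
    ultimately show ?thesis by order
  qed
  ultimately have "emeasure (lebN N) (\<Pi>\<^sub>E i\<in>{..<N}. V i) > 0"
    by (simp add: prod_pos zero_less_iff_neq_zero)
  moreover have "(\<Pi>\<^sub>E i\<in>{..<N}. V i) \<subseteq> U"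
  proof
    fix s assume s: "s \<in> (\<Pi>\<^sub>E i\<in>{..<N}. V i)"
    have "s i \<in> V i" for i
    proof (cases "i < N")
      case False
      then have "s i = t i" using s t by (simp add: PiE_iff extensional_def)
      then show ?thesis using V(1) by (simp add: PiE_iff)
    qed (use s in auto)
    then show "s \<in> U" using V(3) by auto
  qed
  moreover have "(\<Pi>\<^sub>E i\<in>{..<N}. V i) \<in> sets (lebN N)"
    using m by (intro sets_PiM_I_finite) auto
  ultimately show ?thesis using that by blast
qed

text \<open>When only coordinate \<open>k\<close> varies, the logarithm of the weight has a local
  maximum at \<open>t k\<close>. Its derivative is sin (2 t k) times the left side of the claim, and
  this sine is nonzero in the open alcove.\<close>

lemma alcove_weight_stationary:
  assumes t: "t \<in> open_alcove N" and ext: "t \<in> extensional {..<N}" and k: "k < N"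
    and max: "\<And>s. s \<in> trig_alcove N \<Longrightarrow> alcove_weight N a b s \<le> alcove_weight N a b t"
  defines "w \<equiv> \<lambda>i. (sin (t i))\<^sup>2"
  shows "(\<Sum>j\<in>{..<N} - {k}. 1 / (w k - w j)) + (a + b) / (2 * w k) - b / (2 * (1 - w k)) = 0"
proof -
  let ?S = "sin (t k)" and ?C = "cos (t k)"
  define F where "F s = (\<Sum>j<N. \<Sum>i<j. ln (cos (2 * s j) - cos (2 * s i)))
      + (\<Sum>i<N. (a + b) * ln (sin (s i)) + b * ln (2 * cos (s i)))" for s :: "nat \<Rightarrow> real"
  note cos_less = open_alcove_cos_double_less and sc = open_alcove_sin_cos_pos
  have F: "F s = ln (alcove_weight N a b s)" if s: "s \<in> open_alcove N" for s
  proof -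
    have 1: "(\<Prod>j<N. \<Prod>i<j. cos (2 * s j) - cos (2 * s i)) > 0"
      using cos_less[OF s] by (intro prod_pos) auto
    have 2: "(\<Prod>i<N. sin (s i) powr (a + b) * (2 * cos (s i)) powr b) > 0"
      using sc[OF s] by (intro prod_pos) force
    have 0: "(\<Prod>i<j. cos (2 * s j) - cos (2 * s i)) \<noteq> 0" if "j < N" for j
      using cos_less[OF s _ that] by (force simp: prod_zero_iff)
    have "ln (\<Prod>j<N. \<Prod>i<j. cos (2 * s j) - cos (2 * s i)) = (\<Sum>j<N. ln (\<Prod>i<j. cos (2 * s j) - cos (2 * s i)))"
      using 0 by (intro ln_prod) auto
    also have "\<dots> = (\<Sum>j<N. \<Sum>i<j. ln (cos (2 * s j) - cos (2 * s i)))"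
      using cos_less[OF s] by (intro sum.cong ln_prod) fastforce+
    finally have 3: "ln (\<Prod>j<N. \<Prod>i<j. cos (2 * s j) - cos (2 * s i)) = \<dots>" .
    have "ln (\<Prod>i<N. sin (s i) powr (a + b) * (2 * cos (s i)) powr b) = (\<Sum>i<N. ln (sin (s i) powr (a + b) * (2 * cos (s i)) powr b))"
      using sc[OF s] by (intro ln_prod) force+
    also have "\<dots> = (\<Sum>i<N. (a + b) * ln (sin (s i)) + b * ln (2 * cos (s i)))"
    proof (rule sum.cong[OF refl])
      fix i assume "i \<in> {..<N}"
      then show "ln (sin (s i) powr (a + b) * (2 * cos (s i)) powr b) = (a + b) * ln (sin (s i)) + b * ln (2 * cos (s i))"
        using sc[OF s, of i] by (simp add: ln_mult_pos ln_powr)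
    qed
    finally show ?thesis
      unfolding alcove_weight_def F_def using 1 2 3 by (simp add: ln_mult_pos)
  qed
  \<comment> \<open>\<open>g j\<close> is the derivative in \<open>t k\<close> of the logarithm of
    the cosine difference for the pair \<open>j\<close>, \<open>k\<close>. Both orders of the pair
    give the same value, since the sign changes in numerator and denominator alike.\<close>
  define g where "g j = - 2 * sin (2 * t k) / (cos (2 * t k) - cos (2 * t j))" for j
  define d where "d i j = (if j = k then g i else if i = k then g j else 0)" for i j
  have deriv1: "((\<lambda>x. ln (cos (2 * (t(k := x)) j) - cos (2 * (t(k := x)) i))) has_real_derivative d i j) (at (t k))"
    if "i < j" "j < N" for i j
    using cos_less[OF t that] that
    by (auto simp: d_def g_def fun_upd_def intro!: derivative_eq_intros) (simp add: field_simps)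
  have deriv2: "((\<lambda>x. (a + b) * ln (sin ((t(k := x)) i)) + b * ln (2 * cos ((t(k := x)) i))) has_real_derivative
      (if i = k then (a + b) * (?C / ?S) - b * (?S / ?C) else 0)) (at (t k))" if "i < N" for i
    using sc[OF t that]
    by (auto simp: fun_upd_def mult.commute intro!: derivative_eq_intros)
  have "((\<lambda>x. F (t(k := x))) has_real_derivative
      (\<Sum>j<N. \<Sum>i<j. d i j) + (\<Sum>i<N. if i = k then (a + b) * (?C / ?S) - b * (?S / ?C) else 0)) (at (t k))"
    unfolding F_def using deriv1 deriv2 by (intro DERIV_add DERIV_sum) auto
  \<comment> \<open>Openness lets coordinate \<open>k\<close> move in both directions without
    leaving the region where \<open>F\<close> is the logarithm of the weight.\<close>
  moreover have "eventually (\<lambda>x. t(k := x) \<in> open_alcove N) (nhds (t k))"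
  proof -
    have "continuous_on UNIV (\<lambda>x. t(k := x))"
    proof (rule continuous_on_coordinatewise_then_product)
      show "continuous_on UNIV (\<lambda>x. (t(k := x)) i)" for i by (cases "i = k") auto
    qed
    then have "open ((\<lambda>x. t(k := x)) -` open_alcove N)"
      using open_open_alcove by (rule open_vimage[rotated])
    then show ?thesis using t by (auto simp: eventually_nhds)
  qed
  then obtain e where e: "e > 0" "\<And>x. dist x (t k) < e \<Longrightarrow> t(k := x) \<in> open_alcove N"
    by (auto simp: eventually_nhds_metric)
  moreover have "F (t(k := x)) \<le> F (t(k := t k))" if "\<bar>t k - x\<bar> < e" for x
  proof -
    have o: "t(k := x) \<in> open_alcove N" using e(2)[of x] that by (simp add: dist_real_def abs_minus_commute)
    moreover have "t(k := x) \<in> extensional {..<N}" using ext k by (auto simp: extensional_def)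
    ultimately show ?thesis
      using max[OF open_alcove_subset, of "t(k := x)"] alcove_weight_pos[OF o, of a b] by (simp add: F t)
  qed
  ultimately have "(\<Sum>j<N. \<Sum>i<j. d i j) + (\<Sum>i<N. if i = k then (a + b) * (?C / ?S) - b * (?S / ?C) else 0) = 0"
    using DERIV_local_max by blast
  \<comment> \<open>Only pairs containing \<open>k\<close> contribute; it is the larger index for
    partners below \<open>k\<close> and the smaller one for partners above.\<close>
  moreover have "(\<Sum>j<N. \<Sum>i<j. d i j) = sum g ({..<N} - {k})"
  proof -
    have "(\<Sum>i<j. d i j) = (if j = k then sum g {..<k} else if k < j then g j else 0)" for j
    proof -
      have "(\<Sum>i<j. d i j) = (\<Sum>i<j. if i = k then g j else 0)" if "j \<noteq> k"
        using that by (intro sum.cong) (auto simp: d_def)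
      then show ?thesis by (auto simp: d_def sum.delta intro!: sum.cong)
    qed
    then have "(\<Sum>j<N. \<Sum>i<j. d i j) = (\<Sum>j<N. (if j = k then sum g {..<k} else 0) + (if k < j then g j else 0))"
      by (auto intro!: sum.cong)
    also have "\<dots> = sum g {..<k} + sum g ({..<N} \<inter> {j. k < j})"
      using k by (simp add: sum.distrib sum.delta sum.inter_restrict)
    also have "\<dots> = sum g ({..<k} \<union> ({..<N} \<inter> {j. k < j}))"
      by (rule sum.union_disjoint[symmetric]) auto
    also have "{..<k} \<union> ({..<N} \<inter> {j. k < j}) = {..<N} - {k}" using k by auto
    finally show ?thesis .
  qed
  \<comment> \<open>Where \<open>w k = w j\<close>, in particular for \<open>j = k\<close>, both
    sides are 0 by the convention for division by zero.\<close>
  moreover have "g j = 2 * ?S * ?C * (1 / (w k - w j))" for j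
  proof -
    have "cos (2 * t k) - cos (2 * t j) = - 2 * (w k - w j)" by (simp add: cos_double_sin w_def)
    then show ?thesis unfolding g_def by (simp only: sin_double) (cases "w k = w j"; simp add: field_simps)
  qed
  ultimately have *: "2 * ?S * ?C * (\<Sum>j\<in>{..<N} - {k}. 1 / (w k - w j)) + ((a + b) * (?C / ?S) - b * (?S / ?C)) = 0"
    using k by (simp add: sum_distrib_left sum.delta)
  have SC: "?S \<noteq> 0" "?C \<noteq> 0" using sc[OF t k] by auto
  have "2 * ?S * ?C * ((a + b) / (2 * w k)) = (a + b) * (?C / ?S)"
    using SC by (simp add: w_def power2_eq_square)
  moreover have "1 - w k = ?C\<^sup>2" by (simp add: w_def cos_squared_eq)
  then have "2 * ?S * ?C * (b / (2 * (1 - w k))) = b * (?S / ?C)"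
    using SC by (simp add: power2_eq_square)
  ultimately have "2 * ?S * ?C * ((\<Sum>j\<in>{..<N} - {k}. 1 / (w k - w j)) + (a + b) / (2 * w k) - b / (2 * (1 - w k))) = 0"
    using * by (simp only: distrib_left right_diff_distrib)
  with SC show ?thesis by simp
qed

section \<open>Identification of the maximizer\<close>

lemma strict_mono_on_image_unique:
  fixes f g :: "nat \<Rightarrow> 'a::linorder"
  assumes "strict_mono_on {..<n} f" "strict_mono_on {..<n} g" "f ` {..<n} = g ` {..<n}" "i < n"
  shows "f i = g i"
proof -
  have *: "sorted (map h [0..<n]) \<and> distinct (map h [0..<n])" if "strict_mono_on {..<n} h" for h :: "nat \<Rightarrow> 'a"
  proof -
    have "sorted_wrt (<) (map h [0..<n])"
      using that by (auto simp: sorted_wrt_iff_nth_less strict_mono_on_def)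
    then show ?thesis using strict_sorted_iff by blast
  qed
  have "map f [0..<n] = map g [0..<n]"
    using *[OF assms(1)] *[OF assms(2)] assms(3)
    by (intro sorted_distinct_set_unique) (auto simp: atLeast0LessThan)
  then show ?thesis using assms(4) by (simp add: list_eq_iff_nth_eq)
qed

text \<open>Stationarity matches the equilibrium conditions with al + 1 = a + b and be + 1 = b. The
  \<open>t i\<close> decrease in \<open>i\<close> and cosine decreases on [0, pi], so the values cos
  (2 t i) increase like \<open>z\<close>; two increasing enumerations of one finite set
  coincide.\<close>

lemma alcove_weight_maximizer:
  assumes "a \<ge> 0" "b > 0" 
    and z: "strict_mono_on {..<N} z" "z ` {..<N} = {x. jacobiP N (a + b - 1) (b - 1) x = 0}"
    and t: "t \<in> trig_alcove N"
    and max: "\<And>s. s \<in> trig_alcove N \<Longrightarrow> alcove_weight N a b s \<le> alcove_weight N a b t"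
    and pos: "alcove_weight N a b t > 0"
    and i: "i < N"
  shows "t i = arccos (z i) / 2"
proof -
  have o: "t \<in> open_alcove N" using open_alcoveI t pos by (metis less_irrefl)
  have ext: "t \<in> extensional {..<N}" using t by (auto simp: trig_alcove_eq PiE_iff)
  define w where "w = (\<lambda>i. (sin (t i))\<^sup>2)"
  have cos_w: "cos (2 * t k) = 1 - 2 * w k" for k by (simp add: w_def cos_double_sin)
  have mono: "strict_mono_on {..<N} (\<lambda>k. 1 - 2 * w k)"
    using open_alcove_cos_double_less[OF o] by (intro strict_mono_onI) (simp add: cos_w)
  have "{x. jacobiP N (a + b - 1) (b - 1) x = 0} = (\<lambda>k. 1 - 2 * w k) ` {..<N}"
  proof (rule jacobi_zeros_of_stationary)
    show "inj_on w {..<N}"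
      using strict_mono_on_imp_inj_on[OF mono] by (auto simp: inj_on_def)
    fix k assume k: "k < N"
    show "0 < w k" "w k < 1"
      using open_alcove_sin_cos_pos[OF o k] sin_cos_squared_add[of "t k"] zero_less_power[of "cos (t k)" 2]
      unfolding w_def by (simp, linarith)
    show "(\<Sum>j\<in>{..<N} - {k}. 1 / (w k - w j)) + (a + b - 1 + 1) / (2 * w k) - (b - 1 + 1) / (2 * (1 - w k)) = 0"
      using alcove_weight_stationary[OF o ext k max] by (simp add: w_def)
  qed (use assms in auto)
  then have "z i = cos (2 * t i)"
    using strict_mono_on_image_unique[OF z(1) mono _ i] z(2) by (simp add: cos_w)
  moreover have "0 \<le> 2 * t i" "2 * t i \<le> pi"
    using t i by (auto simp: trig_alcove_def)
  ultimately show ?thesis by (simp add: arccos_cos)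
qed

lemma open_alcove_nonempty: "\<exists>t\<in>trig_alcove N. t \<in> open_alcove N"
proof -
  \<comment> \<open>Equally spaced decreasing points: the denominator \<open>N + 1\<close> keeps the
    first below pi / 2, and \<open>i < N\<close> keeps the last above 0.\<close>
  define t where "t = restrict (\<lambda>i. pi / 2 * (real (N - i) / real (N + 1))) {..<N}"
  have "t \<in> open_alcove N"
  proof -
    have "0 < t i \<and> t i < pi / 2" if "i < N" for i
    proof -
      have "real (N - i) / real (N + 1) < 1" "0 < real (N - i) / real (N + 1)" using that by auto
      then have "pi / 2 * (real (N - i) / real (N + 1)) < pi / 2 * 1" "0 < pi / 2 * (real (N - i) / real (N + 1))"
        by (intro mult_strict_left_mono mult_pos_pos; simp)+
      then show ?thesis using that by (simp add: t_def)
    qed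
    moreover have "t j < t i" if "i < j" "j < N" for i j
      using that by (auto simp: t_def intro!: mult_strict_left_mono divide_strict_right_mono)
    ultimately show ?thesis by (simp add: open_alcove_def)
  qed
  moreover have "t \<in> extensional {..<N}" by (simp add: t_def)
  ultimately show ?thesis using open_alcove_subset by blast
qed

section \<open>Measurability and finite volume\<close>

lemma sets_trig_alcove: "trig_alcove N \<in> sets (lebN N)"
proof -
  have [measurable]: "(\<lambda>t. t i) \<in> borel_measurable (lebN N)" if "i < N" for i
    using measurable_component_singleton[of i "{..<N}" "\<lambda>_. lborel"] that by simp
  have "trig_alcove N = {t \<in> space (lebN N). (\<forall>i\<in>{..<N}. 0 \<le> t i \<and> t i \<le> pi / 2) \<and> (\<forall>j\<in>{..<N}. \<forall>i\<in>{..<j}. t j \<le> t i)}"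
    unfolding trig_alcove_def by auto
  also have "\<dots> \<in> sets (lebN N)"
    by (intro sets.sets_Collect_conj sets.sets_Collect_finite_All borel_measurable_le borel_measurable_const) auto
  finally show ?thesis .
qed

lemma emeasure_trig_alcove_finite: "emeasure (lebN N) (trig_alcove N) < \<infinity>"
proof -
  interpret product_sigma_finite "\<lambda>_::nat. lborel :: real measure" ..
  have "emeasure (lebN N) (trig_alcove N) \<le> emeasure (lebN N) (PiE {..<N} (\<lambda>_. {0..pi / 2}))"
    by (intro emeasure_mono sets_PiM_I_finite) (auto simp: trig_alcove_eq)
  also have "\<dots> = (\<Prod>i<N. emeasure lborel {0..pi / 2})"
    by (intro emeasure_PiM) auto
  also have "\<dots> < \<infinity>"
    by (simp add: ennreal_power flip: less_top)
  finally show ?thesis .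
qed

lemma borel_measurable_alcove_weight: "alcove_weight N a b \<in> borel_measurable (lebN N)"
proof -
  have [measurable]: "(\<lambda>t. t i) \<in> borel_measurable (lebN N)" if "i < N" for i
    using measurable_component_singleton[of i "{..<N}" "\<lambda>_. lborel"] that by simp
  show ?thesis
    unfolding alcove_weight_def
    by (intro borel_measurable_times borel_measurable_prod borel_measurable_diff) auto
qed

subsection \<open>Concentration\<close>

text \<open>The normalizing constant is controlled by the mass of \<open>B\<close>: as this is at
  most 1, \<open>c \<kappa>\<close> is at most 1 / (m' powr \<kappa> * vol B). The mass of
  \<open>K\<close> is then at most (m / m') powr \<kappa> * vol A / vol B, which decays
  exponentially.\<close>

lemma laplace_concentration:
  fixes g :: "'a \<Rightarrow> real" and c :: "real \<Rightarrow> real"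
  assumes g: "g \<in> borel_measurable M"
    and A: "A \<in> sets M" "emeasure M A < \<infinity>" and K: "K \<in> sets M"
    and B: "B \<in> sets M" "B \<subseteq> A" "emeasure M B > 0"
    and m: "0 < m" "m < m'"
    and gK: "\<And>x. x \<in> K \<inter> A \<Longrightarrow> 0 \<le> g x \<and> g x \<le> m" and gB: "\<And>x. x \<in> B \<Longrightarrow> m' \<le> g x"
    and c: "\<And>\<kappa>. \<kappa> > 0 \<Longrightarrow> c \<kappa> > 0"
    and P: "\<And>\<kappa>. \<kappa> > 0 \<Longrightarrow> prob_space (P \<kappa>)"
    and dens: "\<And>\<kappa>. \<kappa> > 0 \<Longrightarrow> P \<kappa> = density M (\<lambda>x. ennreal (c \<kappa> * g x powr \<kappa> * indicator A x))"
  shows "((\<lambda>\<kappa>. measure (P \<kappa>) K) \<longlongrightarrow> 0) at_top"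
proof (rule tendsto_sandwich[where f = "\<lambda>_. 0"])
  let ?vA = "measure M A" and ?vB = "measure M B"
  have eA: "emeasure M A = ennreal ?vA" using A(2) by (intro emeasure_eq_ennreal_measure) auto
  have "emeasure M B \<le> emeasure M A" using A(1) B(2) by (rule emeasure_mono[rotated])
  then have eB: "emeasure M B = ennreal ?vB" using A(2) by (intro emeasure_eq_ennreal_measure) auto
  have vB: "?vB > 0" using B(3) unfolding eB by simp
  show "eventually (\<lambda>\<kappa>. measure (P \<kappa>) K \<le> (m / m') powr \<kappa> * (?vA / ?vB)) at_top"
    using eventually_gt_at_top[of 0]
  proof eventually_elim
    case (elim \<kappa>)
    interpret prob_space "P \<kappa>" by (rule P[OF elim])
    let ?f = "\<lambda>x. ennreal (c \<kappa> * g x powr \<kappa> * indicator A x)"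
    have f: "?f \<in> borel_measurable M" using g A(1) by measurable
    have sets: "sets (P \<kappa>) = sets M" by (simp add: dens[OF elim])
    have "ennreal (measure (P \<kappa>) K) = (\<integral>\<^sup>+x. ?f x * indicator K x \<partial>M)"
      unfolding emeasure_eq_measure[symmetric] using K f by (subst dens[OF elim]) (simp add: emeasure_density)
    also have "\<dots> \<le> (\<integral>\<^sup>+x. ennreal (c \<kappa> * m powr \<kappa>) * indicator A x \<partial>M)"
    proof (rule nn_integral_mono)
      fix x
      show "?f x * indicator K x \<le> ennreal (c \<kappa> * m powr \<kappa>) * indicator A x"
        using gK[of x] c[OF elim] elim
        by (auto simp: indicator_def intro!: ennreal_leI mult_left_mono powr_mono2)
    qed
    also have "\<dots> = ennreal (c \<kappa> * m powr \<kappa> * ?vA)"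
      using A(1) c[OF elim] by (simp add: nn_integral_cmult_indicator eA ennreal_mult')
    finally have upper: "measure (P \<kappa>) K \<le> c \<kappa> * m powr \<kappa> * ?vA"
      using c[OF elim] by (subst (asm) ennreal_le_iff) auto
    have "ennreal (c \<kappa> * m' powr \<kappa> * ?vB) = (\<integral>\<^sup>+x. ennreal (c \<kappa> * m' powr \<kappa>) * indicator B x \<partial>M)"
      using B(1) c[OF elim] by (simp add: nn_integral_cmult_indicator eB ennreal_mult')
    also have "\<dots> \<le> (\<integral>\<^sup>+x. ?f x * indicator B x \<partial>M)"
    proof (rule nn_integral_mono)
      fix x
      show "ennreal (c \<kappa> * m' powr \<kappa>) * indicator B x \<le> ?f x * indicator B x"
        using gB[of x] c[OF elim] elim m B(2)
        by (auto simp: indicator_def intro!: ennreal_leI mult_left_mono powr_mono2)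
    qed
    also have "\<dots> = ennreal (measure (P \<kappa>) B)"
      unfolding emeasure_eq_measure[symmetric] using B(1) f by (subst dens[OF elim]) (simp add: emeasure_density)
    also have "\<dots> \<le> ennreal 1" by (intro ennreal_leI) simp
    finally have lower: "c \<kappa> * m' powr \<kappa> * ?vB \<le> 1"
      by (subst (asm) ennreal_le_iff) auto
    have "c \<kappa> \<le> 1 / (m' powr \<kappa> * ?vB)"
      using lower m vB by (simp add: field_simps)
    then have "c \<kappa> * (m powr \<kappa> * ?vA) \<le> 1 / (m' powr \<kappa> * ?vB) * (m powr \<kappa> * ?vA)"
      by (intro mult_right_mono) auto
    also have "\<dots> = (m / m') powr \<kappa> * (?vA / ?vB)"
      using m by (simp add: powr_divide)
    finally show ?case using upper by (simp add: mult_ac)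
  qed
  have "((\<lambda>\<kappa>. (m / m') powr \<kappa>) \<longlongrightarrow> 0) at_top"
  proof -
    have "ln (m / m') < 0" using m by simp
    then have "filterlim (\<lambda>\<kappa>. ln (m / m') * \<kappa>) at_bot at_top"
      by (intro filterlim_tendsto_neg_mult_at_bot[OF tendsto_const] filterlim_ident)
    then have "((\<lambda>\<kappa>. exp (ln (m / m') * \<kappa>)) \<longlongrightarrow> 0) at_top"
      by (rule filterlim_compose[OF exp_at_bot])
    then show ?thesis using m by (simp add: powr_def mult.commute)
  qed
  then show "((\<lambda>\<kappa>. (m / m') powr \<kappa> * (?vA / ?vB)) \<longlongrightarrow> 0) at_top"
    using tendsto_mult_left_zero by blast
qed auto

theorem theorem2p4:
  fixes N :: nat and a b :: real
    and z :: "nat \<Rightarrow> real"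
    and \<Omega> :: "real \<Rightarrow> 'w measure"
    and X :: "real \<Rightarrow> 'w \<Rightarrow> (nat \<Rightarrow> real)"
    and c :: "real \<Rightarrow> real"
  assumes "a \<ge> 0" and "b > 0"
    and "strict_mono_on {..<N} z"
    and "z ` {..<N} = {x. jacobiP N (a + b - 1) (b - 1) x = 0}"
    and "\<And>\<kappa>. \<kappa> > 0 \<Longrightarrow> prob_space (\<Omega> \<kappa>)"
    and "\<And>\<kappa>. \<kappa> > 0 \<Longrightarrow> X \<kappa> \<in> measurable (\<Omega> \<kappa>) (lebN N)"
    and "\<And>\<kappa>. \<kappa> > 0 \<Longrightarrow> c \<kappa> > 0"
    and "\<And>\<kappa>. \<kappa> > 0 \<Longrightarrow> distr (\<Omega> \<kappa>) (lebN N) (X \<kappa>) =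
           density (lebN N) (\<lambda>t. ennreal (c \<kappa> * trig_density N a b \<kappa> t * indicator (trig_alcove N) t))"
  shows "\<forall>\<epsilon>>0. ((\<lambda>\<kappa>. measure (\<Omega> \<kappa>)
            {\<omega> \<in> space (\<Omega> \<kappa>). \<exists>i<N. \<bar>X \<kappa> \<omega> i - arccos (z i) / 2\<bar> \<ge> \<epsilon>})
          \<longlongrightarrow> 0) at_top"
proof (intro allI impI)
  fix \<epsilon> :: real assume "\<epsilon> > 0"
  let ?A = "trig_alcove N" and ?G = "alcove_weight N a b"
  \<comment> \<open>The deviation event, moved to the space of values. Its non-strict inequality is
    a closed condition, so that \<open>K \<inter> ?A\<close> is compact.\<close>
  define K where "K = {t \<in> space (lebN N). \<exists>i\<in>{..<N}. \<epsilon> \<le> \<bar>t i - arccos (z i) / 2\<bar>}"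
  have cont: "continuous_on {t. \<forall>i<N. 0 \<le> t i \<and> t i \<le> pi / 2} ?G"
    using assms(1,2) by (intro continuous_on_alcove_weight) auto
  then have contA: "continuous_on ?A ?G"
    by (rule continuous_on_subset) (auto simp: trig_alcove_def)
  \<comment> \<open>A point of positive weight makes the maximum positive and thereby places the
    maximizer off the walls.\<close>
  obtain s0 where s0: "s0 \<in> ?A" "s0 \<in> open_alcove N" using open_alcove_nonempty by blast
  obtain t where t: "t \<in> ?A" "\<And>s. s \<in> ?A \<Longrightarrow> ?G s \<le> ?G t"
    using continuous_attains_sup[OF compact_trig_alcove _ contA] s0 by blast
  have pos: "?G t > 0" using alcove_weight_pos[OF s0(2)] t(2)[OF s0(1)] by (rule less_le_trans)
  have o: "t \<in> open_alcove N" using open_alcoveI t(1) pos by (metis less_irrefl)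
  have ext: "t \<in> extensional {..<N}" using t(1) by (auto simp: trig_alcove_eq PiE_iff)
  obtain m0 where m0: "m0 < ?G t" "\<And>s. s \<in> K \<inter> ?A \<Longrightarrow> ?G s \<le> m0"
  proof (cases "K \<inter> ?A = {}")
    case False
    have "K \<inter> ?A = ?A \<inter> (\<Union>i\<in>{..<N}. {t. \<epsilon> \<le> \<bar>t i - arccos (z i) / 2\<bar>})"
      by (auto simp: K_def trig_alcove_def)
    moreover have "compact \<dots>"
      by (intro compact_Int_closed compact_trig_alcove closed_UN ballI closed_Collect_le continuous_intros) auto
    ultimately have "compact (K \<inter> ?A)" by simp
    moreover have "continuous_on (K \<inter> ?A) ?G" using contA by (rule continuous_on_subset) auto
    ultimately obtain s where s: "s \<in> K \<inter> ?A" "\<And>r. r \<in> K \<inter> ?A \<Longrightarrow> ?G r \<le> ?G s"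
      using continuous_attains_sup[OF _ False] by blast
    \<comment> \<open>Otherwise \<open>s\<close> would be a maximizer too, its coordinates would be
      the predicted limits, and it could not lie in \<open>K\<close>.\<close>
    have "?G s \<noteq> ?G t"
    proof
      assume "?G s = ?G t"
      then have eq: "s i = arccos (z i) / 2" if "i < N" for i
        using alcove_weight_maximizer[OF assms(1-4), of s i] s(1) t(2) pos that by auto
      have "\<not> \<epsilon> \<le> \<bar>s i - arccos (z i) / 2\<bar>" if "i < N" for i
        unfolding eq[OF that] using \<open>\<epsilon> > 0\<close> by simp
      then show False using s(1) by (auto simp only: K_def)
    qed
    then show ?thesis using that[of "?G s"] s t(2)[of s] by force
  qed (use that[of 0] pos in auto)
  \<comment> \<open>\<open>m0\<close> may be 0, while the Laplace bound needs a positive level;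
    \<open>m'\<close> then leaves room on both sides, above the weight on \<open>K\<close> and below
    the maximum.\<close>
  define m where "m = max m0 (?G t / 2)"
  have m: "0 < m" "m < ?G t" using pos m0(1) by (auto simp: m_def)
  define m' where "m' = (m + ?G t) / 2"
  have m': "m < m'" "m' < ?G t" using m by (auto simp: m'_def)
  \<comment> \<open>A set of positive measure with weight above \<open>m'\<close> is found near
    \<open>t\<close>. The preimage is taken within the open alcove, since that makes it open in the
    whole function space.\<close>
  have "continuous_on (open_alcove N) ?G"
    using cont by (rule continuous_on_subset) (auto simp: open_alcove_def less_imp_le)
  then have U: "open (?G -` {m'<..} \<inter> open_alcove N)"
    using continuous_on_open_vimage[OF open_open_alcove] open_greaterThan by blast
  have "t \<in> ?G -` {m'<..} \<inter> open_alcove N" using o m'(2) by simp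
  then obtain B where B: "B \<in> sets (lebN N)" "emeasure (lebN N) B > 0" "B \<subseteq> ?G -` {m'<..} \<inter> open_alcove N"
    using positive_measure_box[OF U _ ext] by blast
  have "B \<subseteq> ?A"
    using B(3) sets.sets_into_space[OF B(1)] by (force intro: open_alcove_subset simp: space_PiM PiE_iff)
  have coord: "(\<lambda>t. t i) \<in> borel_measurable (lebN N)" if "i < N" for i
    using measurable_component_singleton[of i "{..<N}" "\<lambda>_. lborel"] that by simp
  have K: "K \<in> sets (lebN N)"
    unfolding K_def
    by (intro sets.sets_Collect_finite_Ex borel_measurable_le borel_measurable_const borel_measurable_abs borel_measurable_diff coord) auto
  have "((\<lambda>\<kappa>. measure (distr (\<Omega> \<kappa>) (lebN N) (X \<kappa>)) K) \<longlongrightarrow> 0) at_top"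
  proof (rule laplace_concentration)
    show "\<And>x. x \<in> K \<inter> ?A \<Longrightarrow> 0 \<le> ?G x \<and> ?G x \<le> m"
      using m0(2) alcove_weight_nonneg by (fastforce simp: m_def)
    show "\<And>x. x \<in> B \<Longrightarrow> m' \<le> ?G x" using B(3) by auto
    show "prob_space (distr (\<Omega> \<kappa>) (lebN N) (X \<kappa>))" if "\<kappa> > 0" for \<kappa>
      using that assms(5,6) by (intro prob_space.prob_space_distr)
    show "distr (\<Omega> \<kappa>) (lebN N) (X \<kappa>) = density (lebN N) (\<lambda>x. ennreal (c \<kappa> * ?G x powr \<kappa> * indicator ?A x))"
      if "\<kappa> > 0" for \<kappa>
      using assms(8)[OF that] by (simp add: trig_density_eq)
  qed (use B(1,2) \<open>B \<subseteq> ?A\<close> K m(1) m'(1) assms(7) sets_trig_alcove emeasure_trig_alcove_finite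
      borel_measurable_alcove_weight in auto)
  \<comment> \<open>Pulling \<open>K\<close> back along \<open>X \<kappa>\<close> gives the stated
    event; as the hypotheses concern positive \<kappa> only, the equality is eventual.\<close>
  moreover have "eventually (\<lambda>\<kappa>. measure (distr (\<Omega> \<kappa>) (lebN N) (X \<kappa>)) K =
      measure (\<Omega> \<kappa>) {\<omega> \<in> space (\<Omega> \<kappa>). \<exists>i<N. \<bar>X \<kappa> \<omega> i - arccos (z i) / 2\<bar> \<ge> \<epsilon>}) at_top"
    using eventually_gt_at_top[of 0]
  proof eventually_elim
    case (elim \<kappa>)
    have "X \<kappa> -` K \<inter> space (\<Omega> \<kappa>) = {\<omega> \<in> space (\<Omega> \<kappa>). \<exists>i<N. \<bar>X \<kappa> \<omega> i - arccos (z i) / 2\<bar> \<ge> \<epsilon>}"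
      using measurable_space[OF assms(6)[OF elim]] by (auto simp: K_def)
    then show ?case using measure_distr[OF assms(6)[OF elim] K] by simp
  qed
  ultimately show "((\<lambda>\<kappa>. measure (\<Omega> \<kappa>)
      {\<omega> \<in> space (\<Omega> \<kappa>). \<exists>i<N. \<bar>X \<kappa> \<omega> i - arccos (z i) / 2\<bar> \<ge> \<epsilon>}) \<longlongrightarrow> 0) at_top"
    using tendsto_cong by force
qed

end
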